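(* Let $\mathcal{C}_1=(\mathrm{A}_1,\Gamma_1)$ and $\mathcal{C}_2=(\mathrm{A}_2,\Gamma_2)$ be contracts (with the same input space $\mathcal{U}$ and output space $\mathcal{Y}$). If $\mathcal{C}_1\preccurlyeq\mathcal{C}_2$, i.e. $\mathcal{C}_1$ refines $\mathcal{C}_2$, then the following hold: 1. any environment compatible with $\mathcal{C}_2$ is compatible with $\mathcal{C}_1$; 2. any implementation of $\mathcal{C}_1$ (i.e. any system that implements $\mathcal{C}_1$) is an implementation of $\mathcal{C}_2$.
   Context: All spaces are finite-dimensional real linear spaces and all maps are linear. **Systems.** A system $\Sigma$ with input space $\mathcal{U}$ and output space $\mathcal{Y}$ is given by $\dot x = Ax+Bu+Gd,\ y=Cx$, with state $x\in\mathcal{X}$, input $u\in\mathcal{U}$, output $y\in\mathcal{Y}$, driving variable $d\in\mathcal{D}$. **Systems with constraints.** A system $\Xi_i$ is given by $\dot x_i=A_ix_i+G_id_i,\ w_i=C_ix_i,\ 0=H_ix_i$, with state $x_i\in\mathcal{X}_i$, output $w_i\in\mathcal{W}_i$, driving variable $d_i\in\mathcal{D}_i$. Its *consistent subspace* $\mathcal{V}_i\subset\mathcal{X}_i$ is the set of initial states $x_i(0)$ for which there is $d_i:\mathbb{R}_{\ge0}\to\mathcal{D}_i$ such that the resulting trajectory satisfies $H_ix_i(t)=0$ for all $t\ge0$. Equivalently, $\mathcal{V}_i$ is the largest subspace with $A_i\mathcal{V}_i\subset\mathcal{V}_i+\operatorname{im}G_i$ and $\mathcal{V}_i\subset\ker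 H_i$. **Simulation.** Let $\Xi_1,\Xi_2$ have the same output space, and let $\pi_{\mathcal{X}_i}$ denote projection of subspaces of $\mathcal{X}_1\times\mathcal{X}_2$ onto $\mathcal{X}_i$. A subspace $\mathcal{S}\subset\mathcal{X}_1\times\mathcal{X}_2$ with $\pi_{\mathcal{X}_i}(\mathcal{S})\subset\mathcal{V}_i$, $i=1,2$, is a *simulation relation* of $\Xi_1$ by $\Xi_2$ if for all $(x_1(0),x_2(0))\in\mathcal{S}$ and all $d_1:\mathbb{R}_{\ge0}\to\mathcal{D}_1$ such that $x_1(t)\in\mathcal{V}_1$ for all $t\ge0$, there exists $d_2:\mathbb{R}_{\ge0}\to\mathcal{D}_2$ such that $(x_1(t),x_2(t))\in\mathcal{S}$ and $w_1(t)=w_2(t)$ for all $t\ge0$. A known equivalent algebraic characterization is: for all $(x_1,x_2)\in\mathcal{S}$ and all $d_1\in\mathcal{D}_1$ with $A_1x_1+G_1d_1\in\mathcal{V}_1$, there exists $d_2\in\mathcal{D}_2$ such that $(A_1x_1+G_1d_1,\,A_2x_2+G_2d_2)\in\mathcal{S}$ and $C_1x_1=C_2x_2$. $\Xi_1$ is *simulated by* $\Xi_2$, written $\Xi_1\preccurlyeq\Xi_2$, if there is a simulation relation $\mathcal{S}$ of $\Xi_1$ by $\Xi_2$ with $\pi_{\mathcal{X}_1}(\mathcal{S})=\mathcal{V}_1$. **Environments, assumptions, guarantees, contracts.** An *environment* $\mathrm{E}$ is a constrained system with output $u\in\mathcal{U}$: $\dot x_e=A_ex_e+G_ed_e,\ u=C_ex_e,\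 0=H_ex_e$. *Assumptions* $\mathrm{A}$ are a system of the same form: $\dot x_a=A_ax_a+G_ad_a,\ u=C_ax_a,\ 0=H_ax_a$. *Guarantees* $\Gamma$ are a constrained system with output $(u,y)\in\mathcal{U}\times\mathcal{Y}$: $\dot x_g=A_gx_g+G_gd_g,\ u=C_g^ux_g,\ y=C_g^yx_g,\ 0=H_gx_g$. A *contract* $\mathcal{C}=(\mathrm{A},\Gamma)$ is a pair of assumptions and guarantees. **Interconnection with a system.** For an environment (or assumptions) $\mathrm{E}$ and a system $\Sigma$, $\mathrm{E}\wedge\Sigma$ is the constrained system with state $(x_e,x)\in\mathcal{X}_e\times\mathcal{X}$, driving variable $(d_e,d)$ and output $(u,y)$ given by $\dot x_e=A_ex_e+G_ed_e,\ \dot x=BC_ex_e+Ax+Gd,\ u=C_ex_e,\ y=Cx,\ 0=H_ex_e$. **Implementation.** An environment $\mathrm{E}$ is *compatible* with $\mathcal{C}=(\mathrm{A},\Gamma)$ if $\mathrm{E}\preccurlyeq\mathrm{A}$. A system $\Sigma$ *implements* $\mathcal{C}$ (is an implementation of $\mathcal{C}$) if $\mathrm{E}\wedge\Sigma\preccurlyeq\Gamma$ for every environment $\mathrm{E}$ compatible with $\mathcal{C}$. **Interconnection of assumptions and guarantees.** $\mathrm{A}\wedge\Gamma$ is the constrained system with state $(x_a,x_g)$, driving variable $(d_a,d_g)$ and output $(u,y)$ obtained by equating the outputs $u$ of $\mathrm{A}$ and $\Gamma$: $\dot x_a=A_ax_a+G_ad_a,\ \dot x_g=A_gx_g+G_gd_g,\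 u=C_ax_a,\ y=C_g^yx_g,\ 0=H_ax_a,\ 0=H_gx_g,\ 0=C_ax_a-C_g^ux_g$. **Refinement.** $\mathcal{C}_1=(\mathrm{A}_1,\Gamma_1)$ *refines* $\mathcal{C}_2=(\mathrm{A}_2,\Gamma_2)$, written $\mathcal{C}_1\preccurlyeq\mathcal{C}_2$, if $\mathrm{A}_2\preccurlyeq\mathrm{A}_1$ and $\mathrm{A}_2\wedge\Gamma_1\preccurlyeq\Gamma_2$. *)

theory Defs
  imports "HOL-Analysis.Analysis" "Jordan_Normal_Form.VS_Connect"
begin

unbundle no vec_syntax

text \<open>
  Finite-dimensional spaces are coordinate spaces \<open>\<real>\<^sup>n\<close> (any \<open>n\<close>, including 0), that is
  \<open>carrier_vec n\<close>, so that definitions can quantify over systems with arbitrary state and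
  driving spaces. The product of \<open>\<real>\<^sup>m\<close> and \<open>\<real>\<^sup>n\<close> is \<open>\<real>\<^sup>m\<^sup>+\<^sup>n\<close> via \<open>@\<^sub>v\<close>.
  The state, driving and constraint dimensions of a system are those of its matrices.
\<close>

record system =
  sys_A :: "real mat"
  sys_B :: "real mat"
  sys_G :: "real mat"
  sys_C :: "real mat"

definition wf_system :: "nat \<Rightarrow> nat \<Rightarrow> system \<Rightarrow> bool" where
  "wf_system m p P \<longleftrightarrow>
     (let n = dim_row (sys_A P); k = dim_col (sys_G P) in
      sys_A P \<in> carrier_mat n n \<and> sys_B P \<in> carrier_mat n m \<and>
      sys_G P \<in> carrier_mat n k \<and> sys_C P \<in> carrier_mat p n)"

record constrained_system =
  con_A :: "real mat"
  con_G :: "real mat"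
  con_C :: "real mat"
  con_H :: "real mat"

abbreviation state_dim :: "constrained_system \<Rightarrow> nat" where
  "state_dim \<Xi> \<equiv> dim_row (con_A \<Xi>)"

abbreviation drive_dim :: "constrained_system \<Rightarrow> nat" where
  "drive_dim \<Xi> \<equiv> dim_col (con_G \<Xi>)"

abbreviation constraint_dim :: "constrained_system \<Rightarrow> nat" where
  "constraint_dim \<Xi> \<equiv> dim_row (con_H \<Xi>)"

definition wf_constrained_system :: "nat \<Rightarrow> constrained_system \<Rightarrow> bool" where
  "wf_constrained_system q \<Xi> \<longleftrightarrow>
     con_A \<Xi> \<in> carrier_mat (state_dim \<Xi>) (state_dim \<Xi>) \<and>
     con_G \<Xi> \<in> carrier_mat (state_dim \<Xi>) (drive_dim \<Xi>) \<and>
     con_C \<Xi> \<in> carrier_mat q (state_dim \<Xi>) \<and>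
     con_H \<Xi> \<in> carrier_mat (constraint_dim \<Xi>) (state_dim \<Xi>)"

text \<open>
  Driving variables are the locally integrable functions on \<open>[0, \<infinity>)\<close>, and
  \<open>\<dot>x = A x + G d\<close> is meant in the sense of Caratheodory, i.e.\ in its integrated form.
  The constraint \<open>0 = H x\<close> is not part of this notion. Values at negative times are irrelevant.
\<close>

definition trajectory ::
    "constrained_system \<Rightarrow> (real \<Rightarrow> real vec) \<Rightarrow> (real \<Rightarrow> real vec) \<Rightarrow> bool" where
  "trajectory \<Xi> d x \<longleftrightarrow>
     (\<forall>t\<ge>0. d t \<in> carrier_vec (drive_dim \<Xi>)) \<and>
     (\<forall>t\<ge>0. x t \<in> carrier_vec (state_dim \<Xi>)) \<and>
     (\<forall>t\<ge>0. \<forall>j < drive_dim \<Xi>. (\<lambda>s. d s $ j) absolutely_integrable_on {0..t}) \<and>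
     (\<forall>t\<ge>0. \<forall>i < state_dim \<Xi>.
        ((\<lambda>s. (con_A \<Xi> *\<^sub>v x s + con_G \<Xi> *\<^sub>v d s) $ i) has_integral (x t $ i - x 0 $ i)) {0..t})"

definition consistent :: "constrained_system \<Rightarrow> real vec set" where
  "consistent \<Xi> = {x0 \<in> carrier_vec (state_dim \<Xi>). \<exists>d x. trajectory \<Xi> d x \<and> x 0 = x0 \<and>
     (\<forall>t\<ge>0. con_H \<Xi> *\<^sub>v x t = 0\<^sub>v (constraint_dim \<Xi>))}"

definition linear_relation :: "nat \<Rightarrow> nat \<Rightarrow> (real vec \<times> real vec) set \<Rightarrow> bool" where
  "linear_relation m n S \<longleftrightarrow> S \<subseteq> carrier_vec m \<times> carrier_vec n \<and>
     VectorSpace.subspace class_ring ((\<lambda>(x, y). x @\<^sub>v y) ` S) (module_vec TYPE(real) (m + n))"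

definition simulation_relation ::
    "constrained_system \<Rightarrow> constrained_system \<Rightarrow> (real vec \<times> real vec) set \<Rightarrow> bool" where
  "simulation_relation \<Xi>1 \<Xi>2 S \<longleftrightarrow>
     linear_relation (state_dim \<Xi>1) (state_dim \<Xi>2) S \<and>
     fst ` S \<subseteq> consistent \<Xi>1 \<and> snd ` S \<subseteq> consistent \<Xi>2 \<and>
     (\<forall>(a, b) \<in> S. \<forall>d1 x1.
        trajectory \<Xi>1 d1 x1 \<and> x1 0 = a \<and> (\<forall>t\<ge>0. x1 t \<in> consistent \<Xi>1) \<longrightarrow>
        (\<exists>d2 x2. trajectory \<Xi>2 d2 x2 \<and> x2 0 = b \<and>
           (\<forall>t\<ge>0. (x1 t, x2 t) \<in> S \<and> con_C \<Xi>1 *\<^sub>v x1 t = con_C \<Xi>2 *\<^sub>v x2 t)))"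

definition simulated_by :: "constrained_system \<Rightarrow> constrained_system \<Rightarrow> bool" where
  "simulated_by \<Xi>1 \<Xi>2 \<longleftrightarrow> (\<exists>S. simulation_relation \<Xi>1 \<Xi>2 S \<and> fst ` S = consistent \<Xi>1)"

record guarantees =
  gua_A :: "real mat"
  gua_G :: "real mat"
  gua_Cu :: "real mat"
  gua_Cy :: "real mat"
  gua_H :: "real mat"

definition block_diag :: "real mat \<Rightarrow> real mat \<Rightarrow> real mat" where
  "block_diag M N =
     four_block_mat M (0\<^sub>m (dim_row M) (dim_col N)) (0\<^sub>m (dim_row N) (dim_col M)) N"

definition block_col :: "real mat \<Rightarrow> real mat \<Rightarrow> real mat" where
  "block_col M N = four_block_mat M (0\<^sub>m (dim_row M) 0) N (0\<^sub>m (dim_row N) 0)"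

definition block_row :: "real mat \<Rightarrow> real mat \<Rightarrow> real mat" where
  "block_row M N = four_block_mat M N (0\<^sub>m 0 (dim_col M)) (0\<^sub>m 0 (dim_col N))"

text \<open>Guarantees as a constrained system with the combined output \<open>(u, y)\<close>.\<close>

definition guarantees_system :: "guarantees \<Rightarrow> constrained_system" where
  "guarantees_system \<Gamma> =
     \<lparr>con_A = gua_A \<Gamma>, con_G = gua_G \<Gamma>, con_C = block_col (gua_Cu \<Gamma>) (gua_Cy \<Gamma>), con_H = gua_H \<Gamma>\<rparr>"

definition wf_guarantees :: "nat \<Rightarrow> nat \<Rightarrow> guarantees \<Rightarrow> bool" where
  "wf_guarantees m p \<Gamma> \<longleftrightarrow>
     (let n = dim_row (gua_A \<Gamma>); k = dim_col (gua_G \<Gamma>); h = dim_row (gua_H \<Gamma>) in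
      gua_A \<Gamma> \<in> carrier_mat n n \<and> gua_G \<Gamma> \<in> carrier_mat n k \<and>
      gua_Cu \<Gamma> \<in> carrier_mat m n \<and> gua_Cy \<Gamma> \<in> carrier_mat p n \<and> gua_H \<Gamma> \<in> carrier_mat h n)"

record contract =
  assumption_part :: constrained_system
  guarantee_part :: guarantees

definition wf_contract :: "nat \<Rightarrow> nat \<Rightarrow> contract \<Rightarrow> bool" where
  "wf_contract m p \<C> \<longleftrightarrow>
     wf_constrained_system m (assumption_part \<C>) \<and> wf_guarantees m p (guarantee_part \<C>)"

definition env_interconnect :: "constrained_system \<Rightarrow> system \<Rightarrow> constrained_system" where
  "env_interconnect E P =
     \<lparr>con_A = four_block_mat (con_A E) (0\<^sub>m (dim_row (con_A E)) (dim_col (sys_A P)))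
                (sys_B P * con_C E) (sys_A P),
      con_G = block_diag (con_G E) (sys_G P),
      con_C = block_diag (con_C E) (sys_C P),
      con_H = block_row (con_H E) (0\<^sub>m (dim_row (con_H E)) (dim_col (sys_A P)))\<rparr>"

definition gua_interconnect :: "constrained_system \<Rightarrow> guarantees \<Rightarrow> constrained_system" where
  "gua_interconnect E \<Gamma> =
     \<lparr>con_A = block_diag (con_A E) (gua_A \<Gamma>),
      con_G = block_diag (con_G E) (gua_G \<Gamma>),
      con_C = block_diag (con_C E) (gua_Cy \<Gamma>),
      con_H = block_col (block_diag (con_H E) (gua_H \<Gamma>)) (block_row (con_C E) (- gua_Cu \<Gamma>))\<rparr>"

text \<open>Below, \<open>m\<close> and \<open>p\<close> are the dimensions of the input and output spaces.\<close>

definition compatible :: "nat \<Rightarrow> constrained_system \<Rightarrow> contract \<Rightarrow> bool" where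
  "compatible m E \<C> \<longleftrightarrow> wf_constrained_system m E \<and> simulated_by E (assumption_part \<C>)"

definition implements :: "nat \<Rightarrow> nat \<Rightarrow> system \<Rightarrow> contract \<Rightarrow> bool" where
  "implements m p P \<C> \<longleftrightarrow> wf_system m p P \<and>
     (\<forall>E. compatible m E \<C> \<longrightarrow>
        simulated_by (env_interconnect E P) (guarantees_system (guarantee_part \<C>)))"

definition refines :: "contract \<Rightarrow> contract \<Rightarrow> bool" where
  "refines \<C>1 \<C>2 \<longleftrightarrow>
     simulated_by (assumption_part \<C>2) (assumption_part \<C>1) \<and>
     simulated_by (gua_interconnect (assumption_part \<C>2) (guarantee_part \<C>1))
       (guarantees_system (guarantee_part \<C>2))"

end

theory Submission
  imports Defs
begin

text \<open>
  Simulation is transitive, by composition of relations; this gives the first claim. For the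
  second, let \<open>E\<close> be simulated by \<open>A\<^sub>2\<close> and let \<open>P\<close> implement \<open>(A\<^sub>1, \<Gamma>\<^sub>1)\<close>, so that
  \<open>E \<and> P\<close> is simulated by \<open>\<Gamma>\<^sub>1\<close>. Running the two simulations in parallel along a trajectory of
  \<open>E \<and> P\<close> yields trajectories of \<open>A\<^sub>2\<close> and \<open>\<Gamma>\<^sub>1\<close> that both reproduce the output \<open>u\<close> of \<open>E\<close>;
  hence together they satisfy the coupling constraint of \<open>A\<^sub>2 \<and> \<Gamma>\<^sub>1\<close>. So
  \<open>E \<and> P \<preceq> A\<^sub>2 \<and> \<Gamma>\<^sub>1 \<preceq> \<Gamma>\<^sub>2\<close>.
\<close>

section \<open>Linear relations between coordinate spaces\<close>

lemma smult_append_vec: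
  "c \<cdot>\<^sub>v (v @\<^sub>v w) = (c \<cdot>\<^sub>v v) @\<^sub>v (c \<cdot>\<^sub>v w)"
  by (rule eq_vecI) auto

lemma append_zero_vec: "0\<^sub>v m @\<^sub>v 0\<^sub>v n = 0\<^sub>v (m + n)"
  by (rule eq_vecI) auto

text \<open>Reduces the locale-based notion of subspace to elementary closure conditions. That
  \<open>module_vec\<close> is a module and a vector space over \<open>class_ring\<close> is
  supplied by the library, so only the conditions on \<open>W\<close> remain.\<close>

lemma subspace_module_vec_iff:
  fixes W :: "real vec set"
  shows "VectorSpace.subspace class_ring W (module_vec TYPE(real) n) \<longleftrightarrow>
    W \<subseteq> carrier_vec n \<and> 0\<^sub>v n \<in> W \<and>
    (\<forall>v\<in>W. \<forall>w\<in>W. v + w \<in> W) \<and> (\<forall>c. \<forall>v\<in>W. c \<cdot>\<^sub>v v \<in> W)"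
  using vec_module[of n, where ?'a = real] vec_vs[of n, where ?'a = real]
  unfolding VectorSpace.subspace_def submodule_def
  by (auto simp: module_vec_simps class_ring_simps)

text \<open>Moves the subspace conditions from concatenated vectors back to pairs. This works
  because \<open>@\<^sub>v\<close> is injective once the length of the first part is fixed. All
  later linearity arguments rest on this form.\<close>

lemma linear_relation_iff:
  "linear_relation m n S \<longleftrightarrow>
     S \<subseteq> carrier_vec m \<times> carrier_vec n \<and> (0\<^sub>v m, 0\<^sub>v n) \<in> S \<and>
     (\<forall>x y x' y'. (x, y) \<in> S \<longrightarrow> (x', y') \<in> S \<longrightarrow> (x + x', y + y') \<in> S) \<and>
     (\<forall>c x y. (x, y) \<in> S \<longrightarrow> (c \<cdot>\<^sub>v x, c \<cdot>\<^sub>v y) \<in> S)"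
proof (cases "S \<subseteq> carrier_vec m \<times> carrier_vec n")
  case True
  define T where "T = (\<lambda>(x, y). x @\<^sub>v y) ` S"
  have mem: "x @\<^sub>v y \<in> T \<longleftrightarrow> (x, y) \<in> S" if "x \<in> carrier_vec m" for x y
  proof
    assume "x @\<^sub>v y \<in> T"
    then obtain x' y' where "(x', y') \<in> S" "x @\<^sub>v y = x' @\<^sub>v y'" by (auto simp: T_def)
    moreover from this have "x' \<in> carrier_vec m" using True by auto
    ultimately show "(x, y) \<in> S" using append_vec_eq[OF that] by auto
  qed (force simp: T_def)
  have car: "x \<in> carrier_vec m" "y \<in> carrier_vec n" if "(x, y) \<in> S" for x y
    using that True by blast+
  have zero: "0\<^sub>v (m + n) \<in> T \<longleftrightarrow> (0\<^sub>v m, 0\<^sub>v n) \<in> S"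
    using mem[of "0\<^sub>v m" "0\<^sub>v n"] by (simp add: append_zero_vec)
  have add: "(x @\<^sub>v y) + (x' @\<^sub>v y') \<in> T \<longleftrightarrow> (x + x', y + y') \<in> S"
    if "(x, y) \<in> S" "(x', y') \<in> S" for x y x' y'
    unfolding append_vec_add[OF car(1)[OF that(1)] car(1)[OF that(2)]
        car(2)[OF that(1)] car(2)[OF that(2)]]
    using car that by (intro mem add_carrier_vec)
  have smult: "c \<cdot>\<^sub>v (x @\<^sub>v y) \<in> T \<longleftrightarrow> (c \<cdot>\<^sub>v x, c \<cdot>\<^sub>v y) \<in> S" if "(x, y) \<in> S" for c x y
    unfolding smult_append_vec using car that by (intro mem smult_carrier_vec[THEN iffD2])
  have ball_T: "(\<forall>v\<in>T. Q v) \<longleftrightarrow> (\<forall>x y. (x, y) \<in> S \<longrightarrow> Q (x @\<^sub>v y))" for Q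
    by (auto simp: T_def)
  have "T \<subseteq> carrier_vec (m + n)" using car by (auto simp: T_def)
  then have "linear_relation m n S \<longleftrightarrow>
      0\<^sub>v (m + n) \<in> T \<and>
      (\<forall>v\<in>T. \<forall>w\<in>T. v + w \<in> T) \<and> (\<forall>c. \<forall>v\<in>T. c \<cdot>\<^sub>v v \<in> T)"
    using True unfolding linear_relation_def subspace_module_vec_iff T_def[symmetric] by blast
  also have "(\<forall>v\<in>T. \<forall>w\<in>T. v + w \<in> T) \<longleftrightarrow>
      (\<forall>x y x' y'. (x, y) \<in> S \<longrightarrow> (x', y') \<in> S \<longrightarrow> (x @\<^sub>v y) + (x' @\<^sub>v y') \<in> T)"
    unfolding ball_T by blast
  also have "(\<forall>c. \<forall>v\<in>T. c \<cdot>\<^sub>v v \<in> T) \<longleftrightarrow>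
      (\<forall>c x y. (x, y) \<in> S \<longrightarrow> c \<cdot>\<^sub>v (x @\<^sub>v y) \<in> T)"
    unfolding ball_T by blast
  \<comment> \<open>The facts \<open>add\<close> and \<open>smult\<close> hold only for pairs in
    \<open>S\<close>; the congruence rule makes the premises of each implication available for
    discharging this condition.\<close>
  finally show ?thesis using True by (simp add: zero add smult cong: imp_cong)
qed (simp add: linear_relation_def)

lemma
  assumes "linear_relation m n S"
  shows linear_relation_carrier: "(x, y) \<in> S \<Longrightarrow> x \<in> carrier_vec m \<and> y \<in> carrier_vec n"
    and linear_relation_zero: "(0\<^sub>v m, 0\<^sub>v n) \<in> S"
    and linear_relation_add: "(x, y) \<in> S \<Longrightarrow> (x', y') \<in> S \<Longrightarrow> (x + x', y + y') \<in> S"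
    and linear_relation_smult: "(x, y) \<in> S \<Longrightarrow> (c \<cdot>\<^sub>v x, c \<cdot>\<^sub>v y) \<in> S"
  using assms unfolding linear_relation_iff by (elim conjE; blast)+

lemma linear_relationI:
  assumes "\<And>x y. (x, y) \<in> S \<Longrightarrow> x \<in> carrier_vec m \<and> y \<in> carrier_vec n"
    and "(0\<^sub>v m, 0\<^sub>v n) \<in> S"
    and "\<And>x y x' y'. (x, y) \<in> S \<Longrightarrow> (x', y') \<in> S \<Longrightarrow> (x + x', y + y') \<in> S"
    and "\<And>c x y. (x, y) \<in> S \<Longrightarrow> (c \<cdot>\<^sub>v x, c \<cdot>\<^sub>v y) \<in> S"
  shows "linear_relation m n S"
  unfolding linear_relation_iff using assms(1) by (auto intro: assms(2-4))

text \<open>The intermediate vectors of two composed pairs can be added and scaled together with the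
  pairs themselves.\<close>

lemma linear_relation_relcomp:
  assumes S: "linear_relation m n S" and T: "linear_relation n k T"
  shows "linear_relation m k (S O T)"
proof (rule linear_relationI)
  show "x \<in> carrier_vec m \<and> z \<in> carrier_vec k" if "(x, z) \<in> S O T" for x z
    using that linear_relation_carrier[OF S] linear_relation_carrier[OF T] by auto
  show "(0\<^sub>v m, 0\<^sub>v k) \<in> S O T"
    by (rule relcompI[OF linear_relation_zero[OF S] linear_relation_zero[OF T]])
  show "(x + x', z + z') \<in> S O T" if "(x, z) \<in> S O T" "(x', z') \<in> S O T" for x z x' z'
    using that linear_relation_add[OF S] linear_relation_add[OF T] by (elim relcompEpair) blast
  show "(c \<cdot>\<^sub>v x, c \<cdot>\<^sub>v z) \<in> S O T" if "(x, z) \<in> S O T" for c x z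
    using that linear_relation_smult[OF S] linear_relation_smult[OF T] by (elim relcompEpair) blast
qed

text \<open>A fibre product over a shared state. In the application \<open>x\<close> is the state of
  the environment and \<open>y\<close> that of the system; \<open>v\<close> simulates
  \<open>x\<close> through \<open>S\<close>, while \<open>w\<close> simulates the whole of
  \<open>x @\<^sub>v y\<close> through \<open>T\<close>.\<close>

definition parallel_relation ::
    "nat \<Rightarrow> (real vec \<times> real vec) set \<Rightarrow> (real vec \<times> real vec) set \<Rightarrow> (real vec \<times> real vec) set" where
  "parallel_relation n S T =
     {(x @\<^sub>v y, v @\<^sub>v w) | x y v w. y \<in> carrier_vec n \<and> (x, v) \<in> S \<and> (x @\<^sub>v y, w) \<in> T}"

lemma parallel_relationI:
  "y \<in> carrier_vec n \<Longrightarrow> (x, v) \<in> S \<Longrightarrow> (x @\<^sub>v y, w) \<in> T \<Longrightarrow>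
    (x @\<^sub>v y, v @\<^sub>v w) \<in> parallel_relation n S T"
  unfolding parallel_relation_def by blast

lemma linear_relation_parallel:
  assumes S: "linear_relation m k S" and T: "linear_relation (m + n) l T"
  shows "linear_relation (m + n) (k + l) (parallel_relation n S T)"
proof (rule linear_relationI)
  let ?R = "parallel_relation n S T"
  show "z \<in> carrier_vec (m + n) \<and> q \<in> carrier_vec (k + l)" if "(z, q) \<in> ?R" for z q
    using that linear_relation_carrier[OF S] linear_relation_carrier[OF T]
    by (auto simp: parallel_relation_def)
  show "(0\<^sub>v (m + n), 0\<^sub>v (k + l)) \<in> ?R"
    unfolding append_zero_vec[symmetric]
    by (intro parallel_relationI zero_carrier_vec linear_relation_zero[OF S])
      (simp add: append_zero_vec linear_relation_zero[OF T])
  show "(c \<cdot>\<^sub>v z, c \<cdot>\<^sub>v q) \<in> ?R" if "(z, q) \<in> ?R" for c z q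
  proof -
    from that obtain x y v w where eq: "z = x @\<^sub>v y" "q = v @\<^sub>v w"
      and y: "y \<in> carrier_vec n" and xv: "(x, v) \<in> S" and zw: "(x @\<^sub>v y, w) \<in> T"
      by (auto simp: parallel_relation_def)
    have "(c \<cdot>\<^sub>v x, c \<cdot>\<^sub>v v) \<in> S"
      by (rule linear_relation_smult[OF S xv])
    moreover have "((c \<cdot>\<^sub>v x) @\<^sub>v (c \<cdot>\<^sub>v y), c \<cdot>\<^sub>v w) \<in> T"
      unfolding smult_append_vec[symmetric] by (rule linear_relation_smult[OF T zw])
    ultimately show ?thesis
      unfolding eq smult_append_vec using y by (intro parallel_relationI) auto
  qed
  show "(z + z', q + q') \<in> ?R" if "(z, q) \<in> ?R" "(z', q') \<in> ?R" for z q z' q'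
  proof -
    from that(1) obtain x y v w where eq: "z = x @\<^sub>v y" "q = v @\<^sub>v w"
      and y: "y \<in> carrier_vec n" and xv: "(x, v) \<in> S" and zw: "(x @\<^sub>v y, w) \<in> T"
      by (auto simp: parallel_relation_def)
    from that(2) obtain x' y' v' w' where eq': "z' = x' @\<^sub>v y'" "q' = v' @\<^sub>v w'"
      and y': "y' \<in> carrier_vec n" and xv': "(x', v') \<in> S" and zw': "(x' @\<^sub>v y', w') \<in> T"
      by (auto simp: parallel_relation_def)
    \<comment> \<open>Concatenations add blockwise only when the lengths of the parts agree; the
      carriers of \<open>S\<close> and \<open>T\<close> provide these lengths.\<close>
    have c: "x \<in> carrier_vec m" "x' \<in> carrier_vec m" "v \<in> carrier_vec k" "v' \<in> carrier_vec k"
      "w \<in> carrier_vec l" "w' \<in> carrier_vec l"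
      using linear_relation_carrier[OF S] linear_relation_carrier[OF T] xv xv' zw zw' by blast+
    have z: "z + z' = (x + x') @\<^sub>v (y + y')" and q: "q + q' = (v + v') @\<^sub>v (w + w')"
      unfolding eq eq' using append_vec_add[OF c(1,2) y y'] append_vec_add[OF c(3-6)] by simp_all
    have "(x + x', v + v') \<in> S" by (rule linear_relation_add[OF S xv xv'])
    moreover have "((x + x') @\<^sub>v (y + y'), w + w') \<in> T"
      unfolding z[symmetric] eq eq' by (rule linear_relation_add[OF T zw zw'])
    moreover have "y + y' \<in> carrier_vec n" using y y' by simp
    ultimately show ?thesis
      unfolding z q by (intro parallel_relationI)
  qed
qed

section \<open>Time shifts of trajectories and consistent states\<close>

lemma trajectory_shift:
  assumes tr: "trajectory \<Xi> d x" and T: "0 \<le> T"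
  shows "trajectory \<Xi> (\<lambda>t. d (T + t)) (\<lambda>t. x (T + t))"
  unfolding trajectory_def
proof (intro conjI allI impI)
  fix t :: real assume t: "0 \<le> t"
  show "d (T + t) \<in> carrier_vec (drive_dim \<Xi>)" "x (T + t) \<in> carrier_vec (state_dim \<Xi>)"
    using tr t T by (auto simp: trajectory_def)
  show "(\<lambda>s. d (T + s) $ j) absolutely_integrable_on {0..t}" if j: "j < drive_dim \<Xi>" for j
  proof -
    have "(\<lambda>s. d s $ j) absolutely_integrable_on {0..t + T}"
      using tr t T j by (auto simp: trajectory_def)
    \<comment> \<open>The lower bound is written \<open>0 + T\<close> to match the translation rule
      for integrals over intervals.\<close>
    then have "(\<lambda>s. d s $ j) absolutely_integrable_on {0 + T..t + T}"
      by (rule absolutely_integrable_on_subinterval) (use T in auto)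
    then show ?thesis
      unfolding absolutely_integrable_on_def integrable_on_shift_Icc_real[symmetric]
      by (simp add: o_def)
  qed
  show "((\<lambda>s. (con_A \<Xi> *\<^sub>v x (T + s) + con_G \<Xi> *\<^sub>v d (T + s)) $ i)
      has_integral x (T + t) $ i - x (T + 0) $ i) {0..t}" if i: "i < state_dim \<Xi>" for i
  proof -
    let ?f = "\<lambda>s. (con_A \<Xi> *\<^sub>v x s + con_G \<Xi> *\<^sub>v d s) $ i"
    have int: "(?f has_integral (x s $ i - x 0 $ i)) {0..s}" if "0 \<le> s" for s
      using tr i that by (auto simp: trajectory_def)
    \<comment> \<open>Only integrals starting at 0 are given. Integrability on the later interval
      comes from restriction, and the value \<open>j\<close> of its integral from additivity and
      uniqueness.\<close>
    have "?f integrable_on {T..T + t}"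
      by (rule integrable_on_subinterval[OF has_integral_integrable[OF int[of "T + t"]]])
        (use T t in auto)
    then obtain j where j: "(?f has_integral j) {T..T + t}" by blast
    have "(?f has_integral (x T $ i - x 0 $ i) + j) {0..T + t}"
      by (rule has_integral_combine[OF T _ int[OF T] j]) (use t in simp)
    then have "x T $ i - x 0 $ i + j = x (T + t) $ i - x 0 $ i"
      by (rule has_integral_unique) (use T t in \<open>simp add: int\<close>)
    then have "j = x (T + t) $ i - x T $ i" by simp
    with j have "(?f has_integral x (T + t) $ i - x T $ i) {0 + T..t + T}"
      by (simp add: add.commute)
    then show ?thesis
      unfolding has_integral_shift_Icc_real[symmetric] by (simp add: o_def)
  qed
qed

text \<open>The trajectory shifted by \<open>t\<close> still obeys the constraint, so it witnesses
  consistency of \<open>x t\<close>. Thus a trajectory that satisfies the constraint never leaves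
  the consistent set.\<close>

lemma consistentI:
  assumes "trajectory \<Xi> d x" "\<And>t. 0 \<le> t \<Longrightarrow> con_H \<Xi> *\<^sub>v x t = 0\<^sub>v (constraint_dim \<Xi>)" "0 \<le> t"
  shows "x t \<in> consistent \<Xi>"
proof -
  have "trajectory \<Xi> (\<lambda>s. d (t + s)) (\<lambda>s. x (t + s))"
    by (rule trajectory_shift) fact+
  moreover have "x t \<in> carrier_vec (state_dim \<Xi>)"
    using assms by (auto simp: trajectory_def)
  moreover have "\<forall>s\<ge>0. con_H \<Xi> *\<^sub>v x (t + s) = 0\<^sub>v (constraint_dim \<Xi>)"
    using assms(2,3) by simp
  moreover have "x (t + 0) = x t" by simp
  ultimately show ?thesis unfolding consistent_def by blast
qed

text \<open>Provides a witness in the form that simulation relations demand: a trajectory lying in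
  the consistent set at all times, instead of one satisfying the constraint.\<close>

lemma consistentE:
  assumes "x0 \<in> consistent \<Xi>"
  obtains d x where "trajectory \<Xi> d x" "x 0 = x0" "\<And>t. 0 \<le> t \<Longrightarrow> x t \<in> consistent \<Xi>"
proof -
  from assms obtain d x where "trajectory \<Xi> d x" "x 0 = x0"
    "\<And>t. 0 \<le> t \<Longrightarrow> con_H \<Xi> *\<^sub>v x t = 0\<^sub>v (constraint_dim \<Xi>)"
    by (auto simp: consistent_def)
  then show ?thesis using that consistentI by blast
qed

lemma consistent_constraint:
  "x \<in> consistent \<Xi> \<Longrightarrow> con_H \<Xi> *\<^sub>v x = 0\<^sub>v (constraint_dim \<Xi>)"
  by (auto simp: consistent_def)

section \<open>Simulation relations and their composition\<close>

lemma simulation_relation_linear: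
  "simulation_relation \<Xi>1 \<Xi>2 S \<Longrightarrow> linear_relation (state_dim \<Xi>1) (state_dim \<Xi>2) S"
  unfolding simulation_relation_def by (elim conjE)

lemma simulation_relation_fst: "simulation_relation \<Xi>1 \<Xi>2 S \<Longrightarrow> fst ` S \<subseteq> consistent \<Xi>1"
  unfolding simulation_relation_def by (elim conjE)

lemma simulation_relation_snd: "simulation_relation \<Xi>1 \<Xi>2 S \<Longrightarrow> snd ` S \<subseteq> consistent \<Xi>2"
  unfolding simulation_relation_def by (elim conjE)

text \<open>The matching trajectory stays consistent because each of its states is a second
  component of a pair in \<open>S\<close>. This makes it admissible as the input of a further
  simulation.\<close>

lemma simulation_relationD:
  assumes "simulation_relation \<Xi>1 \<Xi>2 S" "(x1 0, b) \<in> S" "trajectory \<Xi>1 d1 x1"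
    and "\<And>t. 0 \<le> t \<Longrightarrow> x1 t \<in> consistent \<Xi>1"
  obtains d2 x2 where "trajectory \<Xi>2 d2 x2" "x2 0 = b"
    "\<And>t. 0 \<le> t \<Longrightarrow> (x1 t, x2 t) \<in> S"
    "\<And>t. 0 \<le> t \<Longrightarrow> con_C \<Xi>1 *\<^sub>v x1 t = con_C \<Xi>2 *\<^sub>v x2 t"
    "\<And>t. 0 \<le> t \<Longrightarrow> x2 t \<in> consistent \<Xi>2"
proof -
  from assms(1) have "\<forall>(a, b) \<in> S. \<forall>d1 x1.
      trajectory \<Xi>1 d1 x1 \<and> x1 0 = a \<and> (\<forall>t\<ge>0. x1 t \<in> consistent \<Xi>1) \<longrightarrow>
      (\<exists>d2 x2. trajectory \<Xi>2 d2 x2 \<and> x2 0 = b \<and>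
         (\<forall>t\<ge>0. (x1 t, x2 t) \<in> S \<and> con_C \<Xi>1 *\<^sub>v x1 t = con_C \<Xi>2 *\<^sub>v x2 t))"
    unfolding simulation_relation_def by (elim conjE)
  from bspec[OF this assms(2), unfolded prod.case, THEN spec[of _ d1], THEN spec[of _ x1]]
  obtain d2 x2 where *: "trajectory \<Xi>2 d2 x2" "x2 0 = b"
    "\<forall>t\<ge>0. (x1 t, x2 t) \<in> S \<and> con_C \<Xi>1 *\<^sub>v x1 t = con_C \<Xi>2 *\<^sub>v x2 t"
    using assms(3,4) by auto
  moreover have "x2 t \<in> consistent \<Xi>2" if "0 \<le> t" for t
  proof -
    have "(x1 t, x2 t) \<in> S" using *(3) that by blast
    then show ?thesis using simulation_relation_snd[OF assms(1)] by force
  qed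
  ultimately show ?thesis using that by blast
qed

lemma simulation_relationI:
  assumes "linear_relation (state_dim \<Xi>1) (state_dim \<Xi>2) S"
    and "fst ` S \<subseteq> consistent \<Xi>1" "snd ` S \<subseteq> consistent \<Xi>2"
    and follow: "\<And>b d1 x1. (x1 0, b) \<in> S \<Longrightarrow> trajectory \<Xi>1 d1 x1 \<Longrightarrow>
      (\<And>t. 0 \<le> t \<Longrightarrow> x1 t \<in> consistent \<Xi>1) \<Longrightarrow>
      \<exists>d2 x2. trajectory \<Xi>2 d2 x2 \<and> x2 0 = b \<and>
        (\<forall>t\<ge>0. (x1 t, x2 t) \<in> S \<and> con_C \<Xi>1 *\<^sub>v x1 t = con_C \<Xi>2 *\<^sub>v x2 t)"
  shows "simulation_relation \<Xi>1 \<Xi>2 S"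
  unfolding simulation_relation_def Ball_def split_paired_All prod.case
proof (intro conjI allI impI assms(1-3), elim conjE)
  fix a b d1 x1
  assume "(a, b) \<in> S" "trajectory \<Xi>1 d1 x1" "x1 0 = a" "\<forall>t\<ge>0. x1 t \<in> consistent \<Xi>1"
  then show "\<exists>d2 x2. trajectory \<Xi>2 d2 x2 \<and> x2 0 = b \<and>
      (\<forall>t\<ge>0. (x1 t, x2 t) \<in> S \<and> con_C \<Xi>1 *\<^sub>v x1 t = con_C \<Xi>2 *\<^sub>v x2 t)"
    by (intro follow) simp_all
qed

text \<open>A trajectory is matched through \<open>S\<close> first; the match remains in the
  consistent set of \<open>\<Xi>2\<close>, so \<open>T\<close> can match it in turn, and the output
  equations chain.\<close>

lemma simulation_relation_relcomp:
  assumes S: "simulation_relation \<Xi>1 \<Xi>2 S" and T: "simulation_relation \<Xi>2 \<Xi>3 T"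
  shows "simulation_relation \<Xi>1 \<Xi>3 (S O T)"
proof (rule simulation_relationI)
  show "linear_relation (state_dim \<Xi>1) (state_dim \<Xi>3) (S O T)"
    by (rule linear_relation_relcomp[OF simulation_relation_linear[OF S]
          simulation_relation_linear[OF T]])
  have "fst ` (S O T) \<subseteq> fst ` S" "snd ` (S O T) \<subseteq> snd ` T" by force+
  then show "fst ` (S O T) \<subseteq> consistent \<Xi>1" "snd ` (S O T) \<subseteq> consistent \<Xi>3"
    using simulation_relation_fst[OF S] simulation_relation_snd[OF T] by blast+
  show "\<exists>d2 x2. trajectory \<Xi>3 d2 x2 \<and> x2 0 = c \<and>
      (\<forall>t\<ge>0. (x1 t, x2 t) \<in> S O T \<and> con_C \<Xi>1 *\<^sub>v x1 t = con_C \<Xi>3 *\<^sub>v x2 t)"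
    if ac: "(x1 0, c) \<in> S O T" and tr: "trajectory \<Xi>1 d1 x1"
      and con: "\<And>t. 0 \<le> t \<Longrightarrow> x1 t \<in> consistent \<Xi>1" for c d1 x1
  proof -
    from ac obtain b where b: "(x1 0, b) \<in> S" "(b, c) \<in> T" by blast
    obtain d2 x2 where 2: "trajectory \<Xi>2 d2 x2" "x2 0 = b"
      "\<And>t. 0 \<le> t \<Longrightarrow> (x1 t, x2 t) \<in> S"
      "\<And>t. 0 \<le> t \<Longrightarrow> con_C \<Xi>1 *\<^sub>v x1 t = con_C \<Xi>2 *\<^sub>v x2 t"
      "\<And>t. 0 \<le> t \<Longrightarrow> x2 t \<in> consistent \<Xi>2"
      using simulation_relationD[OF S b(1) tr con] by metis
    have "(x2 0, c) \<in> T" using b(2) 2(2) by simp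
    from simulation_relationD[OF T this 2(1,5)] obtain d3 x3 where
      "trajectory \<Xi>3 d3 x3" "x3 0 = c"
      "\<And>t. 0 \<le> t \<Longrightarrow> (x2 t, x3 t) \<in> T"
      "\<And>t. 0 \<le> t \<Longrightarrow> con_C \<Xi>2 *\<^sub>v x2 t = con_C \<Xi>3 *\<^sub>v x3 t"
      by metis
    with 2 show ?thesis
      by (metis relcomp.relcompI)
  qed
qed

lemma simulated_by_trans:
  assumes "simulated_by \<Xi>1 \<Xi>2" "simulated_by \<Xi>2 \<Xi>3"
  shows "simulated_by \<Xi>1 \<Xi>3"
proof -
  from assms obtain S T where S: "simulation_relation \<Xi>1 \<Xi>2 S" "fst ` S = consistent \<Xi>1"
    and T: "simulation_relation \<Xi>2 \<Xi>3 T" "fst ` T = consistent \<Xi>2"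
    unfolding simulated_by_def by blast
  \<comment> \<open>Every partner under \<open>S\<close> is consistent for \<open>\<Xi>2\<close> and
    therefore has a partner under \<open>T\<close>, so the composition still covers all consistent
    states of \<open>\<Xi>1\<close>.\<close>
  have "snd ` S \<subseteq> fst ` T" using simulation_relation_snd[OF S(1)] T(2) by simp
  then have "fst ` S \<subseteq> fst ` (S O T)" by force
  then have "fst ` (S O T) = consistent \<Xi>1" using S(2) by force
  then show ?thesis
    using simulation_relation_relcomp[OF S(1) T(1)] unfolding simulated_by_def by blast
qed

section \<open>Block matrices and the matrices of interconnections\<close>

lemma block_diag_mult_vec:
  assumes "a \<in> carrier_vec (dim_col M)" "d \<in> carrier_vec (dim_col N)"
  shows "block_diag M N *\<^sub>v (a @\<^sub>v d) = (M *\<^sub>v a) @\<^sub>v (N *\<^sub>v d)"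
proof -
  have "block_diag M N *\<^sub>v (a @\<^sub>v d)
      = (M *\<^sub>v a + 0\<^sub>m (dim_row M) (dim_col N) *\<^sub>v d)
        @\<^sub>v (0\<^sub>m (dim_row N) (dim_col M) *\<^sub>v a + N *\<^sub>v d)"
    unfolding block_diag_def by (rule four_block_mat_mult_vec) (use assms in auto)
  then show ?thesis using assms by auto
qed

lemma block_col_mult_vec:
  assumes "a \<in> carrier_vec (dim_col M)" "dim_col N = dim_col M"
  shows "block_col M N *\<^sub>v a = (M *\<^sub>v a) @\<^sub>v (N *\<^sub>v a)"
proof -
  have "M \<in> carrier_mat (dim_row M) (dim_col M)" "N \<in> carrier_mat (dim_row N) (dim_col M)"
    using assms(2) by auto
  \<comment> \<open>\<open>append_rows\<close> unfolds to the same four-block matrix, whose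
    right-hand blocks have no columns.\<close>
  from mat_mult_append[OF this assms(1)] show ?thesis
    unfolding block_col_def append_rows_def .
qed

lemma block_row_mult_vec:
  assumes "a \<in> carrier_vec (dim_col M)" "d \<in> carrier_vec (dim_col N)" "dim_row N = dim_row M"
  shows "block_row M N *\<^sub>v (a @\<^sub>v d) = M *\<^sub>v a + N *\<^sub>v d"
proof -
  have "block_row M N *\<^sub>v (a @\<^sub>v d)
      = (M *\<^sub>v a + N *\<^sub>v d) @\<^sub>v (0\<^sub>m 0 (dim_col M) *\<^sub>v a + 0\<^sub>m 0 (dim_col N) *\<^sub>v d)"
    unfolding block_row_def by (rule four_block_mat_mult_vec) (use assms in auto)
  \<comment> \<open>The lower blocks have no rows, so the appended vector has length 0.\<close>
  also have "\<dots> = M *\<^sub>v a + N *\<^sub>v d" using assms by (intro eq_vecI) auto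
  finally show ?thesis .
qed

lemma block_dims [simp]:
  "dim_row (block_diag M N) = dim_row M + dim_row N"
  "dim_col (block_diag M N) = dim_col M + dim_col N"
  "dim_row (block_col M N) = dim_row M + dim_row N"
  "dim_col (block_col M N) = dim_col M"
  "dim_row (block_row M N) = dim_row M"
  "dim_col (block_row M N) = dim_col M + dim_col N"
  by (simp_all add: block_diag_def block_col_def block_row_def)

lemma env_interconnect_dims [simp]:
  "state_dim (env_interconnect E P) = state_dim E + dim_row (sys_A P)"
  "drive_dim (env_interconnect E P) = drive_dim E + dim_col (sys_G P)"
  "constraint_dim (env_interconnect E P) = constraint_dim E"
  by (simp_all add: env_interconnect_def)

lemma gua_interconnect_dims [simp]:
  "state_dim (gua_interconnect E \<Gamma>) = state_dim E + dim_row (gua_A \<Gamma>)"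
  "drive_dim (gua_interconnect E \<Gamma>) = drive_dim E + dim_col (gua_G \<Gamma>)"
  "constraint_dim (gua_interconnect E \<Gamma>) =
     constraint_dim E + dim_row (gua_H \<Gamma>) + dim_row (con_C E)"
  by (simp_all add: gua_interconnect_def)

lemma wf_constrained_system_dims:
  assumes "wf_constrained_system q \<Xi>"
  shows "dim_col (con_A \<Xi>) = state_dim \<Xi>" "dim_row (con_G \<Xi>) = state_dim \<Xi>"
    "dim_row (con_C \<Xi>) = q" "dim_col (con_C \<Xi>) = state_dim \<Xi>"
    "dim_col (con_H \<Xi>) = state_dim \<Xi>"
  using assms by (simp_all only: wf_constrained_system_def carrier_mat_def mem_Collect_eq)

lemma wf_system_dims:
  assumes "wf_system m p P"
  shows "dim_col (sys_A P) = dim_row (sys_A P)" "dim_row (sys_B P) = dim_row (sys_A P)"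
    "dim_col (sys_B P) = m" "dim_row (sys_G P) = dim_row (sys_A P)"
    "dim_row (sys_C P) = p" "dim_col (sys_C P) = dim_row (sys_A P)"
  using assms by (simp_all only: wf_system_def Let_def carrier_mat_def mem_Collect_eq)

lemma wf_guarantees_dims:
  assumes "wf_guarantees m p \<Gamma>"
  shows "dim_col (gua_A \<Gamma>) = dim_row (gua_A \<Gamma>)" "dim_row (gua_G \<Gamma>) = dim_row (gua_A \<Gamma>)"
    "dim_row (gua_Cu \<Gamma>) = m" "dim_col (gua_Cu \<Gamma>) = dim_row (gua_A \<Gamma>)"
    "dim_row (gua_Cy \<Gamma>) = p" "dim_col (gua_Cy \<Gamma>) = dim_row (gua_A \<Gamma>)"
    "dim_col (gua_H \<Gamma>) = dim_row (gua_A \<Gamma>)"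
  using assms by (simp_all only: wf_guarantees_def Let_def carrier_mat_def mem_Collect_eq)

lemma env_interconnect_constraint:
  assumes "wf_constrained_system m E" "wf_system m p P"
    and "x \<in> carrier_vec (state_dim E)" "y \<in> carrier_vec (dim_row (sys_A P))"
  shows "con_H (env_interconnect E P) *\<^sub>v (x @\<^sub>v y) = con_H E *\<^sub>v x"
proof -
  have "con_H (env_interconnect E P) *\<^sub>v (x @\<^sub>v y)
      = con_H E *\<^sub>v x + 0\<^sub>m (dim_row (con_H E)) (dim_col (sys_A P)) *\<^sub>v y"
    unfolding env_interconnect_def constrained_system.simps
    by (rule block_row_mult_vec)
      (use assms wf_constrained_system_dims[OF assms(1)] wf_system_dims[OF assms(2)] in simp_all)
  also have "0\<^sub>m (dim_row (con_H E)) (dim_col (sys_A P)) *\<^sub>v y = 0\<^sub>v (dim_row (con_H E))"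
    using assms(4) wf_system_dims[OF assms(2)] by auto
  also have "con_H E *\<^sub>v x + 0\<^sub>v (dim_row (con_H E)) = con_H E *\<^sub>v x"
    by (rule eq_vecI) simp_all
  finally show ?thesis .
qed

lemma env_interconnect_output:
  assumes "wf_constrained_system m E" "wf_system m p P"
    and "x \<in> carrier_vec (state_dim E)" "y \<in> carrier_vec (dim_row (sys_A P))"
  shows "con_C (env_interconnect E P) *\<^sub>v (x @\<^sub>v y) = (con_C E *\<^sub>v x) @\<^sub>v (sys_C P *\<^sub>v y)"
  unfolding env_interconnect_def constrained_system.simps
  by (rule block_diag_mult_vec)
    (use assms(3,4) wf_constrained_system_dims[OF assms(1)] wf_system_dims[OF assms(2)] in simp_all)

lemma guarantees_system_output:
  assumes "wf_guarantees m p \<Gamma>" "x \<in> carrier_vec (dim_row (gua_A \<Gamma>))"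
  shows "con_C (guarantees_system \<Gamma>) *\<^sub>v x = (gua_Cu \<Gamma> *\<^sub>v x) @\<^sub>v (gua_Cy \<Gamma> *\<^sub>v x)"
  unfolding guarantees_system_def constrained_system.simps
  by (rule block_col_mult_vec) (use assms wf_guarantees_dims[OF assms(1)] in simp_all)

lemma gua_interconnect_output:
  assumes "wf_constrained_system m E" "wf_guarantees m p \<Gamma>"
    and "x \<in> carrier_vec (state_dim E)" "y \<in> carrier_vec (dim_row (gua_A \<Gamma>))"
  shows "con_C (gua_interconnect E \<Gamma>) *\<^sub>v (x @\<^sub>v y) = (con_C E *\<^sub>v x) @\<^sub>v (gua_Cy \<Gamma> *\<^sub>v y)"
  unfolding gua_interconnect_def constrained_system.simps
  by (rule block_diag_mult_vec)
    (use assms(3,4) wf_constrained_system_dims[OF assms(1)] wf_guarantees_dims[OF assms(2)] in simp_all)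

text \<open>The three equations assumed are the three stacked layers of the constraint: the
  constraint of each component, and the agreement of the two copies of \<open>u\<close>, encoded as
  a difference by the negated block.\<close>

lemma gua_interconnect_constraint:
  assumes E: "wf_constrained_system m E" and \<Gamma>: "wf_guarantees m p \<Gamma>"
    and x: "x \<in> carrier_vec (state_dim E)" and y: "y \<in> carrier_vec (dim_row (gua_A \<Gamma>))"
    and "con_H E *\<^sub>v x = 0\<^sub>v (constraint_dim E)" "gua_H \<Gamma> *\<^sub>v y = 0\<^sub>v (dim_row (gua_H \<Gamma>))"
    and "con_C E *\<^sub>v x = gua_Cu \<Gamma> *\<^sub>v y"
  shows "con_H (gua_interconnect E \<Gamma>) *\<^sub>v (x @\<^sub>v y) =
    0\<^sub>v (constraint_dim (gua_interconnect E \<Gamma>))"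
proof -
  note wf = wf_constrained_system_dims[OF E] wf_guarantees_dims[OF \<Gamma>]
  have "con_H (gua_interconnect E \<Gamma>) *\<^sub>v (x @\<^sub>v y)
      = (block_diag (con_H E) (gua_H \<Gamma>) *\<^sub>v (x @\<^sub>v y))
        @\<^sub>v (block_row (con_C E) (- gua_Cu \<Gamma>) *\<^sub>v (x @\<^sub>v y))"
    unfolding gua_interconnect_def constrained_system.simps
    by (rule block_col_mult_vec) (use wf x y in auto)
  also have "block_diag (con_H E) (gua_H \<Gamma>) *\<^sub>v (x @\<^sub>v y) = (con_H E *\<^sub>v x) @\<^sub>v (gua_H \<Gamma> *\<^sub>v y)"
    by (rule block_diag_mult_vec) (use wf x y in auto)
  also have "block_row (con_C E) (- gua_Cu \<Gamma>) *\<^sub>v (x @\<^sub>v y)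
      = con_C E *\<^sub>v x + (- gua_Cu \<Gamma>) *\<^sub>v y"
    by (rule block_row_mult_vec) (use wf x y in auto)
  also have "(- gua_Cu \<Gamma>) *\<^sub>v y = - (gua_Cu \<Gamma> *\<^sub>v y)"
    by (rule eq_vecI) (use wf y in auto)
  also have "con_C E *\<^sub>v x + - (gua_Cu \<Gamma> *\<^sub>v y) = 0\<^sub>v (dim_row (con_C E))"
    using assms(7) wf by (intro eq_vecI) auto
  finally show ?thesis
    using assms(5,6) by (simp add: append_zero_vec)
qed

section \<open>Projecting and pairing trajectories of interconnections\<close>

lemma trajectory_env_interconnect_fst:
  assumes E: "wf_constrained_system m E" and P: "wf_system m p P"
    and tr: "trajectory (env_interconnect E P) d x"
  shows "trajectory E (\<lambda>t. vec_first (d t) (drive_dim E)) (\<lambda>t. vec_first (x t) (state_dim E))"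
  unfolding trajectory_def
proof (intro conjI allI impI)
  note wf = wf_constrained_system_dims[OF E] wf_system_dims[OF P]
  let ?n = "dim_row (sys_A P)" and ?k = "dim_col (sys_G P)"
  let ?xe = "\<lambda>t. vec_first (x t) (state_dim E)" and ?de = "\<lambda>t. vec_first (d t) (drive_dim E)"
  fix t :: real assume t: "0 \<le> t"
  show "(\<lambda>s. ?de s $ j) absolutely_integrable_on {0..t}" if "j < drive_dim E" for j
    using tr t that by (auto simp: trajectory_def vec_first_def)
  show "((\<lambda>s. (con_A E *\<^sub>v ?xe s + con_G E *\<^sub>v ?de s) $ i)
      has_integral ?xe t $ i - ?xe 0 $ i) {0..t}" if i: "i < state_dim E" for i
  proof -
    let ?I = "env_interconnect E P"
    \<comment> \<open>Dimensions of \<open>x s\<close> and \<open>d s\<close> are known only for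
      nonnegative times, which suffices because all integrals run over
      \<open>{0..t}\<close>.\<close>
    have eq: "(con_A ?I *\<^sub>v x s + con_G ?I *\<^sub>v d s) $ i
        = (con_A E *\<^sub>v ?xe s + con_G E *\<^sub>v ?de s) $ i" if "0 \<le> s" for s
    proof -
      have xs: "x s = ?xe s @\<^sub>v vec_last (x s) ?n" and ds: "d s = ?de s @\<^sub>v vec_last (d s) ?k"
        using tr that by (simp_all add: trajectory_def)
      \<comment> \<open>The upper right block is zero: the system does not feed back into the
        environment, whose part of the state evolves on its own.\<close>
      have "con_A ?I *\<^sub>v (?xe s @\<^sub>v vec_last (x s) ?n)
          = (con_A E *\<^sub>v ?xe s + 0\<^sub>m (state_dim E) (dim_col (sys_A P)) *\<^sub>v vec_last (x s) ?n)
            @\<^sub>v (sys_B P * con_C E *\<^sub>v ?xe s + sys_A P *\<^sub>v vec_last (x s) ?n)"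
        unfolding env_interconnect_def constrained_system.simps
        by (rule four_block_mat_mult_vec) (use wf in auto)
      moreover have "con_G ?I *\<^sub>v (?de s @\<^sub>v vec_last (d s) ?k)
          = (con_G E *\<^sub>v ?de s) @\<^sub>v (sys_G P *\<^sub>v vec_last (d s) ?k)"
        unfolding env_interconnect_def constrained_system.simps
        by (rule block_diag_mult_vec) auto
      ultimately show ?thesis
        using i wf by (subst xs, subst ds) auto
    qed
    have "((\<lambda>s. (con_A ?I *\<^sub>v x s + con_G ?I *\<^sub>v d s) $ i)
        has_integral x t $ i - x 0 $ i) {0..t}"
      using tr t i by (auto simp: trajectory_def)
    then have "((\<lambda>s. (con_A E *\<^sub>v ?xe s + con_G E *\<^sub>v ?de s) $ i)
        has_integral x t $ i - x 0 $ i) {0..t}"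
      by (rule has_integral_eq[rotated]) (use eq in auto)
    then show ?thesis using i by (simp add: vec_first_def)
  qed
qed auto

text \<open>The dynamics are block diagonal, and the coupling of the two outputs \<open>u\<close>
  sits in the constraint, which is not part of \<open>trajectory\<close>. Hence any two trajectories
  can be paired.\<close>

lemma trajectory_gua_interconnect:
  assumes E: "wf_constrained_system m E" and \<Gamma>: "wf_guarantees m p \<Gamma>"
    and tr: "trajectory E d x" and tr': "trajectory (guarantees_system \<Gamma>) d' x'"
  shows "trajectory (gua_interconnect E \<Gamma>) (\<lambda>t. d t @\<^sub>v d' t) (\<lambda>t. x t @\<^sub>v x' t)"
  unfolding trajectory_def
proof (intro conjI allI impI)
  note wf = wf_constrained_system_dims[OF E] wf_guarantees_dims[OF \<Gamma>]
  have c: "d s \<in> carrier_vec (drive_dim E)" "x s \<in> carrier_vec (state_dim E)"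
    "d' s \<in> carrier_vec (dim_col (gua_G \<Gamma>))" "x' s \<in> carrier_vec (dim_row (gua_A \<Gamma>))"
    if "0 \<le> s" for s
    using tr tr' that by (auto simp: trajectory_def guarantees_system_def)
  let ?I = "gua_interconnect E \<Gamma>"
  fix t :: real assume t: "0 \<le> t"
  show "d t @\<^sub>v d' t \<in> carrier_vec (drive_dim ?I)" "x t @\<^sub>v x' t \<in> carrier_vec (state_dim ?I)"
    using c[OF t] by auto
  show "(\<lambda>s. (d s @\<^sub>v d' s) $ j) absolutely_integrable_on {0..t}" if j: "j < drive_dim ?I" for j
  proof (cases "j < drive_dim E")
    case True
    then have "(\<lambda>s. d s $ j) absolutely_integrable_on {0..t}"
      using tr t by (auto simp: trajectory_def)
    moreover have "(d s @\<^sub>v d' s) $ j = d s $ j" if "s \<in> {0..t}" for s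
      using c[of s] that True by auto
    ultimately show ?thesis
      \<comment> \<open>Absolute integrability is set integrability for Lebesgue measure, so
        agreement of the integrands on the interval is enough.\<close>
      by (simp only: set_integrable_cong[OF refl refl,
            of "{0..t}" "\<lambda>s. (d s @\<^sub>v d' s) $ j" "\<lambda>s. d s $ j"])
  next
    case False
    then have "(\<lambda>s. d' s $ (j - drive_dim E)) absolutely_integrable_on {0..t}"
      using tr' t j by (auto simp: trajectory_def guarantees_system_def)
    moreover have "(d s @\<^sub>v d' s) $ j = d' s $ (j - drive_dim E)" if "s \<in> {0..t}" for s
      using c[of s] that False j by auto
    ultimately show ?thesis
      by (simp only: set_integrable_cong[OF refl refl,
            of "{0..t}" "\<lambda>s. (d s @\<^sub>v d' s) $ j" "\<lambda>s. d' s $ (j - drive_dim E)"])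
  qed
  show "((\<lambda>s. (con_A ?I *\<^sub>v (x s @\<^sub>v x' s) + con_G ?I *\<^sub>v (d s @\<^sub>v d' s)) $ i)
      has_integral (x t @\<^sub>v x' t) $ i - (x 0 @\<^sub>v x' 0) $ i) {0..t}" if i: "i < state_dim ?I" for i
  proof -
    have eq: "con_A ?I *\<^sub>v (x s @\<^sub>v x' s) + con_G ?I *\<^sub>v (d s @\<^sub>v d' s)
        = (con_A E *\<^sub>v x s + con_G E *\<^sub>v d s) @\<^sub>v (gua_A \<Gamma> *\<^sub>v x' s + gua_G \<Gamma> *\<^sub>v d' s)"
      if "0 \<le> s" for s
    proof -
      have "con_A ?I *\<^sub>v (x s @\<^sub>v x' s) = (con_A E *\<^sub>v x s) @\<^sub>v (gua_A \<Gamma> *\<^sub>v x' s)"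
        and "con_G ?I *\<^sub>v (d s @\<^sub>v d' s) = (con_G E *\<^sub>v d s) @\<^sub>v (gua_G \<Gamma> *\<^sub>v d' s)"
        unfolding gua_interconnect_def constrained_system.simps
        by (rule block_diag_mult_vec; use wf c[OF that] in auto)+
      then show ?thesis
        using append_vec_add[of "con_A E *\<^sub>v x s" "state_dim E" "con_G E *\<^sub>v d s"
            "gua_A \<Gamma> *\<^sub>v x' s" "dim_row (gua_A \<Gamma>)" "gua_G \<Gamma> *\<^sub>v d' s"] wf c[OF that]
        by auto
    qed
    show ?thesis
    proof (cases "i < state_dim E")
      case True
      have "((\<lambda>s. (con_A E *\<^sub>v x s + con_G E *\<^sub>v d s) $ i)
          has_integral x t $ i - x 0 $ i) {0..t}"
        using tr t True by (auto simp: trajectory_def)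
      then have "((\<lambda>s. (con_A ?I *\<^sub>v (x s @\<^sub>v x' s) + con_G ?I *\<^sub>v (d s @\<^sub>v d' s)) $ i)
          has_integral x t $ i - x 0 $ i) {0..t}"
        by (rule has_integral_eq[rotated]) (use True wf in \<open>auto simp: eq\<close>)
      then show ?thesis using c[OF t] c[of 0] True by auto
    next
      case False
      let ?i = "i - state_dim E"
      have "((\<lambda>s. (gua_A \<Gamma> *\<^sub>v x' s + gua_G \<Gamma> *\<^sub>v d' s) $ ?i)
          has_integral x' t $ ?i - x' 0 $ ?i) {0..t}"
        using tr' t False i by (auto simp: trajectory_def guarantees_system_def)
      then have "((\<lambda>s. (con_A ?I *\<^sub>v (x s @\<^sub>v x' s) + con_G ?I *\<^sub>v (d s @\<^sub>v d' s)) $ i)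
          has_integral x' t $ ?i - x' 0 $ ?i) {0..t}"
        by (rule has_integral_eq[rotated]) (use False i wf in \<open>auto simp: eq\<close>)
      then show ?thesis using c[OF t] c[of 0] False i by auto
    qed
  qed
qed

section \<open>Simulation of interconnections and contract refinement\<close>

lemma consistent_env_interconnect_fst:
  assumes E: "wf_constrained_system m E" and P: "wf_system m p P"
    and z: "z \<in> consistent (env_interconnect E P)"
  shows "vec_first z (state_dim E) \<in> consistent E"
proof -
  from z obtain d x where tr: "trajectory (env_interconnect E P) d x" and x0: "x 0 = z"
    and H: "\<And>t. 0 \<le> t \<Longrightarrow> con_H (env_interconnect E P) *\<^sub>v x t = 0\<^sub>v (constraint_dim E)"
    by (auto simp: consistent_def)
  \<comment> \<open>The constraint matrix of the interconnection vanishes on the system state, so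
    the constraint on \<open>x t\<close> is that of \<open>E\<close> on its first part.\<close>
  have "con_H E *\<^sub>v vec_first (x t) (state_dim E) = 0\<^sub>v (constraint_dim E)" if "0 \<le> t" for t
  proof -
    have "x t = vec_first (x t) (state_dim E) @\<^sub>v vec_last (x t) (dim_row (sys_A P))"
      using tr that by (simp add: trajectory_def)
    then show ?thesis
      using H[OF that] env_interconnect_constraint[OF E P, of "vec_first (x t) (state_dim E)"]
      by (metis vec_first_carrier vec_last_carrier)
  qed
  from consistentI[OF trajectory_env_interconnect_fst[OF E P tr] this, of 0] x0
  show ?thesis by simp
qed

text \<open>Applied with \<open>A\<close> the assumptions of \<open>\<C>2\<close> and
  \<open>\<Gamma>\<close> the guarantees of \<open>\<C>1\<close>: compatibility with
  \<open>\<C>2\<close> then supplies \<open>EA\<close>, and implementation of \<open>\<C>1\<close>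
  supplies \<open>EP\<close>.\<close>

lemma env_interconnect_simulated_by_gua_interconnect:
  assumes E: "wf_constrained_system m E" and A: "wf_constrained_system m A"
    and P: "wf_system m p P" and \<Gamma>: "wf_guarantees m p \<Gamma>"
    and EA: "simulated_by E A"
    and EP: "simulated_by (env_interconnect E P) (guarantees_system \<Gamma>)"
  shows "simulated_by (env_interconnect E P) (gua_interconnect A \<Gamma>)"
proof -
  let ?EP = "env_interconnect E P" and ?A\<Gamma> = "gua_interconnect A \<Gamma>"
  let ?n = "dim_row (sys_A P)"
  from EA obtain S where S: "simulation_relation E A S" and S1: "fst ` S = consistent E"
    unfolding simulated_by_def by blast
  from EP obtain T where T: "simulation_relation ?EP (guarantees_system \<Gamma>) T"
    and T1: "fst ` T = consistent ?EP"
    unfolding simulated_by_def by blast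
  define R where "R = parallel_relation ?n S T"
  have linS: "linear_relation (state_dim E) (state_dim A) S"
    by (rule simulation_relation_linear[OF S])
  have linT: "linear_relation (state_dim E + ?n) (dim_row (gua_A \<Gamma>)) T"
    using simulation_relation_linear[OF T] by (simp add: guarantees_system_def)
  have lin: "linear_relation (state_dim ?EP) (state_dim ?A\<Gamma>) R"
    using linear_relation_parallel[OF linS linT] by (simp add: R_def)
  \<comment> \<open>The constraint equation goes beyond what a simulation relation asks for; it is
    carried along because the same statement also yields consistency of the second components of
    \<open>R\<close>.\<close>
  have follow: "\<exists>d2 x2. trajectory ?A\<Gamma> d2 x2 \<and> x2 0 = b \<and>
      (\<forall>t\<ge>0. (x1 t, x2 t) \<in> R \<and> con_C ?EP *\<^sub>v x1 t = con_C ?A\<Gamma> *\<^sub>v x2 t \<and>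
        con_H ?A\<Gamma> *\<^sub>v x2 t = 0\<^sub>v (constraint_dim ?A\<Gamma>))"
    if ab: "(x1 0, b) \<in> R" and tr: "trajectory ?EP d1 x1"
      and con: "\<And>t. 0 \<le> t \<Longrightarrow> x1 t \<in> consistent ?EP" for b d1 x1
  proof -
    define xe where "xe t = vec_first (x1 t) (state_dim E)" for t
    define xp where "xp t = vec_last (x1 t) ?n" for t
    have x1: "x1 t = xe t @\<^sub>v xp t" if "0 \<le> t" for t
      using tr that by (simp add: trajectory_def xe_def xp_def)
    have [simp]: "xe t \<in> carrier_vec (state_dim E)" "xp t \<in> carrier_vec ?n" for t
      by (auto simp: xe_def xp_def)
    from ab obtain x y a g where xy: "x1 0 = x @\<^sub>v y" and b: "b = a @\<^sub>v g"
      and xa: "(x, a) \<in> S" and xg: "(x1 0, g) \<in> T"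
      by (auto simp: R_def parallel_relation_def)
    have x: "x \<in> carrier_vec (state_dim E)"
      using linear_relation_carrier[OF linS xa] by blast
    \<comment> \<open>The split of \<open>x1 0\<close> obtained from \<open>R\<close> coincides with
      the canonical one, since \<open>x\<close> has the length of an environment state.\<close>
    have "x @\<^sub>v y = xe 0 @\<^sub>v xp 0" using x1[of 0] xy by simp
    then have "x = xe 0"
      by (rule append_vec_eq[THEN iffD1, THEN conjunct1, rotated 2]) (rule x, simp)
    with xa have xa: "(xe 0, a) \<in> S" by simp
    have trE: "trajectory E (\<lambda>t. vec_first (d1 t) (drive_dim E)) xe"
      unfolding xe_def by (rule trajectory_env_interconnect_fst[OF E P tr])
    have conE: "xe t \<in> consistent E" if "0 \<le> t" for t
      using consistent_env_interconnect_fst[OF E P con[OF that]] by (simp add: xe_def)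
    obtain da xa where a: "trajectory A da xa" "xa 0 = a"
      "\<And>t. 0 \<le> t \<Longrightarrow> (xe t, xa t) \<in> S"
      "\<And>t. 0 \<le> t \<Longrightarrow> con_C E *\<^sub>v xe t = con_C A *\<^sub>v xa t"
      "\<And>t. 0 \<le> t \<Longrightarrow> xa t \<in> consistent A"
      using simulation_relationD[OF S _ trE conE] xa by blast
    obtain dg xg where g: "trajectory (guarantees_system \<Gamma>) dg xg" "xg 0 = g"
      "\<And>t. 0 \<le> t \<Longrightarrow> (x1 t, xg t) \<in> T"
      "\<And>t. 0 \<le> t \<Longrightarrow> con_C ?EP *\<^sub>v x1 t = con_C (guarantees_system \<Gamma>) *\<^sub>v xg t"
      "\<And>t. 0 \<le> t \<Longrightarrow> xg t \<in> consistent (guarantees_system \<Gamma>)"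
      using simulation_relationD[OF T _ tr con] xg by blast
    have "(x1 t, xa t @\<^sub>v xg t) \<in> R \<and>
        con_C ?EP *\<^sub>v x1 t = con_C ?A\<Gamma> *\<^sub>v (xa t @\<^sub>v xg t) \<and>
        con_H ?A\<Gamma> *\<^sub>v (xa t @\<^sub>v xg t) = 0\<^sub>v (constraint_dim ?A\<Gamma>)" if t: "0 \<le> t" for t
    proof (intro conjI)
      have ca: "xa t \<in> carrier_vec (state_dim A)" and cg: "xg t \<in> carrier_vec (dim_row (gua_A \<Gamma>))"
        using a(1) g(1) t by (auto simp: trajectory_def guarantees_system_def)
      \<comment> \<open>Both copies of \<open>u\<close> have length \<open>m\<close>, so an equation
        between combined outputs separates into one for \<open>u\<close> and one for
        \<open>y\<close>.\<close>
      have "con_C E *\<^sub>v xe t \<in> carrier_vec m" "gua_Cu \<Gamma> *\<^sub>v xg t \<in> carrier_vec m"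
        by (simp_all only: carrier_vec_def mem_Collect_eq dim_mult_mat_vec
            wf_constrained_system_dims(3)[OF E] wf_guarantees_dims(3)[OF \<Gamma>])
      note append_eqD = append_vec_eq[OF this, THEN iffD1]
      have out: "con_C ?EP *\<^sub>v x1 t = (con_C E *\<^sub>v xe t) @\<^sub>v (sys_C P *\<^sub>v xp t)"
        unfolding x1[OF t] by (rule env_interconnect_output[OF E P]) simp_all
      have "(con_C E *\<^sub>v xe t) @\<^sub>v (sys_C P *\<^sub>v xp t)
          = (gua_Cu \<Gamma> *\<^sub>v xg t) @\<^sub>v (gua_Cy \<Gamma> *\<^sub>v xg t)"
        unfolding out[symmetric] g(4)[OF t] by (rule guarantees_system_output[OF \<Gamma> cg])
      then have u: "con_C E *\<^sub>v xe t = gua_Cu \<Gamma> *\<^sub>v xg t"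
        and y: "sys_C P *\<^sub>v xp t = gua_Cy \<Gamma> *\<^sub>v xg t"
        using append_eqD by blast+
      show "(x1 t, xa t @\<^sub>v xg t) \<in> R"
        using a(3)[OF t] g(3)[OF t] unfolding R_def x1[OF t] by (intro parallel_relationI) auto
      \<comment> \<open>The interconnection reads \<open>u\<close> from \<open>A\<close> and
        \<open>y\<close> from \<open>\<Gamma>\<close>, so each of the two simulations contributes
        one half of the output.\<close>
      show "con_C ?EP *\<^sub>v x1 t = con_C ?A\<Gamma> *\<^sub>v (xa t @\<^sub>v xg t)"
        unfolding out gua_interconnect_output[OF A \<Gamma> ca cg] a(4)[OF t] y ..
      show "con_H ?A\<Gamma> *\<^sub>v (xa t @\<^sub>v xg t) = 0\<^sub>v (constraint_dim ?A\<Gamma>)"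
      proof (rule gua_interconnect_constraint[OF A \<Gamma> ca cg])
        show "con_H A *\<^sub>v xa t = 0\<^sub>v (constraint_dim A)"
          by (rule consistent_constraint[OF a(5)[OF t]])
        show "gua_H \<Gamma> *\<^sub>v xg t = 0\<^sub>v (dim_row (gua_H \<Gamma>))"
          using consistent_constraint[OF g(5)[OF t]] by (simp add: guarantees_system_def)
        show "con_C A *\<^sub>v xa t = gua_Cu \<Gamma> *\<^sub>v xg t"
          using a(4)[OF t] u by (rule trans[OF sym])
      qed
    qed
    moreover have "trajectory ?A\<Gamma> (\<lambda>t. da t @\<^sub>v dg t) (\<lambda>t. xa t @\<^sub>v xg t)"
      by (rule trajectory_gua_interconnect[OF A \<Gamma> a(1) g(1)])
    moreover have "xa 0 @\<^sub>v xg 0 = b" using a(2) g(2) b by simp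
    ultimately show ?thesis by blast
  qed
  have fst_sub: "fst ` R \<subseteq> consistent ?EP"
    using T1 by (force simp: R_def parallel_relation_def)
  have fst_sup: "consistent ?EP \<subseteq> fst ` R"
  proof
    fix z assume z: "z \<in> consistent ?EP"
    \<comment> \<open>\<open>T\<close> covers all consistent states of the interconnection, and
      \<open>S\<close> all those of \<open>E\<close>. The projection of \<open>z\<close> is
      consistent for \<open>E\<close>, so both partners exist.\<close>
    then obtain g where g: "(z, g) \<in> T" using T1 by force
    obtain a where a: "(vec_first z (state_dim E), a) \<in> S"
      using consistent_env_interconnect_fst[OF E P z] S1 by force
    have "z = vec_first z (state_dim E) @\<^sub>v vec_last z ?n"
      using z by (simp add: consistent_def)
    with a g have "(z, a @\<^sub>v g) \<in> R"
      unfolding R_def by (metis parallel_relationI vec_last_carrier)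
    then show "z \<in> fst ` R" by force
  qed
  have snd_sub: "snd ` R \<subseteq> consistent ?A\<Gamma>"
  proof clarsimp
    fix z b assume zb: "(z, b) \<in> R"
    \<comment> \<open>To show that \<open>b\<close> is consistent, some consistent trajectory is
      started at its partner \<open>z\<close>; \<open>follow\<close> answers with a trajectory from
      \<open>b\<close> that satisfies the constraint.\<close>
    then have "z \<in> consistent ?EP" using fst_sub by force
    then obtain d1 x1 where tr: "trajectory ?EP d1 x1" and x0: "x1 0 = z"
      and con: "\<And>t. 0 \<le> t \<Longrightarrow> x1 t \<in> consistent ?EP"
      by (rule consistentE) blast
    have "(x1 0, b) \<in> R" using zb x0 by simp
    from follow[OF this tr con] obtain d2 x2 where "trajectory ?A\<Gamma> d2 x2" "x2 0 = b"
      "\<And>t. 0 \<le> t \<Longrightarrow> con_H ?A\<Gamma> *\<^sub>v x2 t = 0\<^sub>v (constraint_dim ?A\<Gamma>)"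
      by blast
    then show "b \<in> consistent ?A\<Gamma>" using consistentI[of ?A\<Gamma> d2 x2 0] by simp
  qed
  have "simulation_relation ?EP ?A\<Gamma> R"
  proof (rule simulation_relationI[OF lin fst_sub snd_sub])
    fix b d1 x1
    assume "(x1 0, b) \<in> R" "trajectory ?EP d1 x1" "\<And>t. 0 \<le> t \<Longrightarrow> x1 t \<in> consistent ?EP"
    from follow[OF this] show "\<exists>d2 x2. trajectory ?A\<Gamma> d2 x2 \<and> x2 0 = b \<and>
        (\<forall>t\<ge>0. (x1 t, x2 t) \<in> R \<and> con_C ?EP *\<^sub>v x1 t = con_C ?A\<Gamma> *\<^sub>v x2 t)"
      by blast
  qed
  then show ?thesis
    unfolding simulated_by_def using fst_sub fst_sup by blast
qed

theorem theorem4: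
  fixes m p :: nat and \<C>1 \<C>2 :: contract
  assumes "wf_contract m p \<C>1" and "wf_contract m p \<C>2"
    and "refines \<C>1 \<C>2"
  shows "(\<forall>E. compatible m E \<C>2 \<longrightarrow> compatible m E \<C>1) \<and>
         (\<forall>P. implements m p P \<C>1 \<longrightarrow> implements m p P \<C>2)"
proof (intro conjI allI impI)
  show comp: "compatible m E \<C>1" if "compatible m E \<C>2" for E
    using that assms(3) simulated_by_trans unfolding compatible_def refines_def by blast
  show "implements m p P \<C>2" if P: "implements m p P \<C>1" for P
    unfolding implements_def
  proof (intro conjI allI impI)
    show wfP: "wf_system m p P" using P by (simp add: implements_def)
    fix E assume E: "compatible m E \<C>2"
    \<comment> \<open>By the first claim \<open>E\<close> is also compatible with
      \<open>\<C>1\<close>, so the implementation property of \<open>P\<close> applies to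
      it.\<close>
    have "simulated_by (env_interconnect E P) (guarantees_system (guarantee_part \<C>1))"
      using P comp[OF E] by (simp add: implements_def)
    then have "simulated_by (env_interconnect E P)
        (gua_interconnect (assumption_part \<C>2) (guarantee_part \<C>1))"
      using env_interconnect_simulated_by_gua_interconnect E wfP assms(1,2)
      unfolding compatible_def wf_contract_def by blast
    then show "simulated_by (env_interconnect E P) (guarantees_system (guarantee_part \<C>2))"
      using assms(3) simulated_by_trans unfolding refines_def by blast
  qed
qed

end
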